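(* Let $X$ be a random vector in $\mathbb{R}^n$ with probability density $f$, where $f\in L^\alpha(\mathbb{R}^n)$ for each $\alpha>0$. For each $\alpha>0$ let $X_\alpha$ be a random vector in $\mathbb{R}^n$ with density $$f_\alpha(x)=\frac{f^\alpha(x)}{\int_{\mathbb{R}^n} f^\alpha}.$$ If $K=K(f):=\sup_{\alpha>0}V(X_\alpha)$, then $$\mathbf{E}\big[e^{\beta\{\tilde h(X)-h(X)\}}\big]\leq e^{K r(-\beta)},\qquad \beta\in\mathbb{R},$$ where $r(u)=u-\log(1+u)$ for $u>-1$ and $r(u)=+\infty$ for $u\le -1$.
   Context: No log-concavity is assumed. Here $f\in L^\alpha(\mathbb{R}^n)$ means $\int_{\mathbb{R}^n} f^\alpha<\infty$ (also for $0<\alpha<1$). For a random vector $Y$ in $\mathbb{R}^n$ with density $g$, the information content is the random variable $\tilde h(Y)=-\log g(Y)$, the entropy is $h(Y)=\mathbf{E}[\tilde h(Y)]=-\int_{\mathbb{R}^n} g\log g$, and the varentropy is $V(Y)=\mathrm{Var}(\tilde h(Y))$. Thus $\tilde h(X)=-\log f(X)$ and $V(X_\alpha)=\mathrm{Var}(\log f_\alpha(X_\alpha))$. *)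

theory Defs
  imports "HOL-Probability.Probability"
begin

(* ln 0 = 0 in HOL, whereas -log 0 should be +\<infinity>; the difference is confined to the
   event that g(Y) = 0, which is null whenever g is the density of Y. *)
definition info_content :: "('b \<Rightarrow> real) \<Rightarrow> ('a \<Rightarrow> 'b) \<Rightarrow> 'a \<Rightarrow> real" where
  "info_content g Y \<omega> = - ln (g (Y \<omega>))"

definition diff_entropy :: "'a measure \<Rightarrow> ('b \<Rightarrow> real) \<Rightarrow> ('a \<Rightarrow> 'b) \<Rightarrow> real" where
  "diff_entropy M g Y = (LINT \<omega>|M. info_content g Y \<omega>)"

(* The variance of the information content as an extended nonnegative number, so that
   it is \<infinity> (and not 0, as with the Bochner integral) if the second moment is infinite. *)
definition varentropy :: "'a measure \<Rightarrow> ('b \<Rightarrow> real) \<Rightarrow> ('a \<Rightarrow> 'b) \<Rightarrow> ennreal" where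
  "varentropy M g Y =
     (\<integral>\<^sup>+\<omega>. ennreal ((info_content g Y \<omega> - diff_entropy M g Y)\<^sup>2) \<partial>M)"

definition power_density :: "('a::euclidean_space \<Rightarrow> real) \<Rightarrow> real \<Rightarrow> 'a \<Rightarrow> real" where
  "power_density f \<alpha> x = f x powr \<alpha> / (LINT y|lborel. f y powr \<alpha>)"

definition rate_fun :: "real \<Rightarrow> ereal" where
  "rate_fun u = (if u > -1 then ereal (u - ln (1 + u)) else \<infinity>)"

(* In K * r(-\<beta>) the HOL convention 0 * \<infinity> = 0 applies. It matters for \<beta> = 0 with
   K = \<infinity>, and for \<beta> \<ge> 1 with K = 0; the bound then reads E[...] \<le> 1. *)
definition exp_ext :: "ereal \<Rightarrow> ennreal" where
  "exp_ext x =
     (case x of ereal t \<Rightarrow> ennreal (exp t) | PInfty \<Rightarrow> \<infinity> | MInfty \<Rightarrow> 0)"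

lemma exp_ext_simps [simp]:
  "exp_ext (ereal t) = ennreal (exp t)" "exp_ext \<infinity> = \<infinity>" "exp_ext (-\<infinity>) = 0"
  by (simp_all add: exp_ext_def flip: MInfty_eq_minfinity)

lemma diff_entropy_eq_integral:
  fixes g :: "'b::euclidean_space \<Rightarrow> real"
  assumes "distributed M lborel Y (\<lambda>x. ennreal (g x))" and "\<And>x. 0 \<le> g x"
  shows "diff_entropy M g Y = - (LINT x|lborel. g x * ln (g x))"
proof -
  have [measurable]: "g \<in> borel_measurable lborel"
    using distributed_real_measurable[of lborel g M Y] assms by simp
  have "(LINT x|lborel. g x * - ln (g x)) = (LINT \<omega>|M. - ln (g (Y \<omega>)))"
    using assms by (intro distributed_integral) auto
  then show ?thesis
    by (simp add: diff_entropy_def info_content_def)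
qed

lemma diff_entropy_eq_entropy:
  fixes g :: "'b::euclidean_space \<Rightarrow> real"
  assumes "prob_space M"
    and "distributed M lborel Y (\<lambda>x. ennreal (g x))" and "\<And>x. 0 \<le> g x"
  shows "diff_entropy M g Y = prob_space.entropy M (exp 1) lborel Y"
proof -
  interpret information_space M "exp 1"
    using assms(1) by (simp add: information_space_def information_space_axioms_def)
  show ?thesis
    using entropy_distr[of lborel Y g] diff_entropy_eq_integral[of M Y g] assms(2,3)
    by (simp add: log_def)
qed

lemma varentropy_eq_variance:
  assumes "prob_space M"
    and "integrable M (info_content g Y)" and "integrable M (\<lambda>\<omega>. (info_content g Y \<omega>)\<^sup>2)"
  shows "varentropy M g Y = ennreal (prob_space.variance M (info_content g Y))"
proof -
  interpret prob_space M by fact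
  have "integrable M (\<lambda>\<omega>. (info_content g Y \<omega> - diff_entropy M g Y)\<^sup>2)"
    using assms(2,3) by (simp add: power2_diff)
  then show ?thesis
    unfolding varentropy_def
    by (subst nn_integral_eq_integral) (simp_all add: diff_entropy_def)
qed

end

theory Submission
  imports Defs
begin

text \<open>
  Put \<open>F \<alpha> = ln (\<integral> f\<^sup>\<alpha>)\<close>, the cumulant generating function of \<open>ln f\<close> under the density
  \<open>f\<close>, shifted by one. Since \<open>f\<close> is a density, \<open>F 1 = 0\<close>, and for \<open>\<beta> < 1\<close> the exponential
  moment in question is \<open>exp (F (1 - \<beta>) - \<beta> h)\<close>, where \<open>h\<close> is the entropy of \<open>X\<close>.

  Differentiating twice, \<open>F' \<alpha>\<close> and \<open>F'' \<alpha>\<close> are the mean and the variance of \<open>ln f\<close> under the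
  tilted density \<open>f\<^sup>\<alpha> / \<integral> f\<^sup>\<alpha>\<close>. In particular \<open>F' 1 = - h\<close>, and as \<open>ln f\<^sub>\<alpha> = \<alpha> ln f - F \<alpha>\<close>,
  the varentropy of \<open>X\<^sub>\<alpha>\<close> is \<open>\<alpha>\<^sup>2 F'' \<alpha>\<close> (\<open>varentropy_power_density\<close>). Hence
  \<open>F'' \<alpha> \<le> K / \<alpha>\<^sup>2\<close>. The right-hand side is the second derivative of \<open>K (\<alpha> - 1 - ln \<alpha>)\<close>, which
  vanishes to first order at \<open>1\<close>, so comparing with the tangent of \<open>F\<close> at \<open>1\<close> gives
  \<open>F \<alpha> + (\<alpha> - 1) h \<le> K (\<alpha> - 1 - ln \<alpha>)\<close> (\<open>ln_log_moment_0_le\<close>). At \<open>\<alpha> = 1 - \<beta>\<close> this is the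
  logarithm of the claim.

  The analytic work is to differentiate \<open>\<integral> f\<^sup>\<alpha>\<close> under the integral sign
  (\<open>log_moment_has_derivative\<close>). Finiteness of \<open>\<integral> f\<^sup>\<alpha>\<close> on an open range of exponents suffices:
  any power of \<open>\<bar>ln f\<bar>\<close> is dominated by a small positive plus a small negative power of \<open>f\<close>.

  If \<open>\<beta> \<ge> 1\<close>, the bound is infinite unless \<open>K = 0\<close>, and then the information content of
  \<open>X\<close> is almost surely constant.
\<close>

section \<open>Exponential estimates\<close>

lemma exp_abs_remainder: "\<bar>exp s - 1 - s\<bar> \<le> s\<^sup>2 * exp \<bar>s\<bar>" for s :: real
proof -
  obtain t where t: "\<bar>t\<bar> \<le> \<bar>s\<bar>" "exp s = (\<Sum>m<2. s ^ m / fact m) + exp t / fact 2 * s ^ 2"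
    using Maclaurin_exp_le[of s 2] by blast
  have "\<bar>exp s - 1 - s\<bar> = s\<^sup>2 * (exp t / 2)"
    using t(2) by (simp add: eval_nat_numeral abs_mult)
  also have "\<dots> \<le> s\<^sup>2 * exp \<bar>s\<bar>"
  proof (intro mult_left_mono)
    have "exp t \<le> exp \<bar>s\<bar>" using t(1) by simp
    then show "exp t / 2 \<le> exp \<bar>s\<bar>" using exp_gt_zero[of t] by linarith
  qed simp
  finally show ?thesis .
qed

lemma exp_abs_le: "exp \<bar>s\<bar> \<le> exp s + exp (- s)" for s :: real
  by (cases "s \<ge> 0") auto

section \<open>Logarithmic moments of a function with finite power integrals\<close>

locale finite_powers =
  fixes \<mu> :: "'a measure" and f :: "'a \<Rightarrow> real"
  assumes measurable_f [measurable]: "f \<in> borel_measurable \<mu>"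
    and nonneg_f: "0 \<le> f x"
    and integrable_powr: "\<alpha> > 0 \<Longrightarrow> integrable \<mu> (\<lambda>x. f x powr \<alpha>)"
    and not_null: "\<not> (AE x in \<mu>. f x = 0)"
begin

text \<open>
  The derivatives of \<open>\<integral> f\<^sup>\<alpha>\<close> in the exponent. Points where \<open>f\<close> vanishes contribute
  nothing, since \<open>0 powr \<alpha> = 0\<close>, so the value \<open>ln 0 = 0\<close> has no effect.
\<close>

definition log_moment :: "nat \<Rightarrow> real \<Rightarrow> real" where
  "log_moment k \<alpha> = (LINT x|\<mu>. f x powr \<alpha> * ln (f x) ^ k)"

text \<open>
  The factor \<open>exp (\<delta> * \<bar>ln f\<bar>)\<close>, which majorises every power of \<open>\<bar>ln f\<bar>\<close> up to a constant, only
  costs a shift of the exponent by \<open>\<delta>\<close> in one of the two directions.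
\<close>

lemma powr_exp_ln_split:
  "f x powr \<alpha> * exp (\<delta> * \<bar>ln (f x)\<bar>) \<le> f x powr (\<alpha> + \<delta>) + f x powr (\<alpha> - \<delta>)" if "\<delta> > 0"
proof (cases "f x = 0")
  case False
  then have pos: "f x > 0" using nonneg_f[of x] by simp
  have "exp (\<delta> * \<bar>ln (f x)\<bar>) \<le> exp (\<delta> * ln (f x)) + exp (- (\<delta> * ln (f x)))"
    using exp_abs_le[of "\<delta> * ln (f x)"] that by (simp add: abs_mult)
  then have "exp (\<alpha> * ln (f x)) * exp (\<delta> * \<bar>ln (f x)\<bar>)
      \<le> exp (\<alpha> * ln (f x)) * (exp (\<delta> * ln (f x)) + exp (- (\<delta> * ln (f x))))"
    by (intro mult_left_mono) auto
  also have "\<dots> = exp (\<alpha> * ln (f x) + \<delta> * ln (f x)) + exp (\<alpha> * ln (f x) - \<delta> * ln (f x))"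
    by (simp add: exp_add exp_diff exp_minus field_simps)
  finally show ?thesis
    using pos by (simp add: powr_def algebra_simps)
qed simp

text \<open>
  One factor \<open>\<bar>ln f\<bar>\<close> at a time is traded for a shift of the exponent by \<open>\<alpha> / 2\<close>; this keeps all
  exponents positive, so the induction hypothesis applies to the shifted ones.
\<close>

lemma integrable_powr_ln_power:
  "\<alpha> > 0 \<Longrightarrow> integrable \<mu> (\<lambda>x. f x powr \<alpha> * ln (f x) ^ k)"
proof (induction k arbitrary: \<alpha>)
  case 0
  then show ?case by (simp add: integrable_powr)
next
  case (Suc k)
  define \<delta> where "\<delta> = \<alpha> / 2"
  have \<delta>: "\<delta> > 0" "\<alpha> + \<delta> > 0" "\<alpha> - \<delta> > 0" using Suc.prems by (auto simp: \<delta>_def)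
  let ?g = "\<lambda>x. (\<bar>f x powr (\<alpha> + \<delta>) * ln (f x) ^ k\<bar> + \<bar>f x powr (\<alpha> - \<delta>) * ln (f x) ^ k\<bar>) / \<delta>"
  show ?case
  proof (rule Bochner_Integration.integrable_bound[where f = ?g])
    show "integrable \<mu> ?g"
      using Suc.IH[OF \<delta>(2)] Suc.IH[OF \<delta>(3)]
      by (intro integrable_divide Bochner_Integration.integrable_add integrable_abs) auto
    have "norm (f x powr \<alpha> * ln (f x) ^ Suc k) \<le> norm (?g x)" for x
    proof -
      have "\<delta> * \<bar>ln (f x)\<bar> \<le> exp (\<delta> * \<bar>ln (f x)\<bar>)"
        using exp_ge_add_one_self[of "\<delta> * \<bar>ln (f x)\<bar>"] by linarith
      then have "f x powr \<alpha> * (\<delta> * \<bar>ln (f x)\<bar>) \<le> f x powr \<alpha> * exp (\<delta> * \<bar>ln (f x)\<bar>)"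
        by (intro mult_left_mono) auto
      also have "\<dots> \<le> f x powr (\<alpha> + \<delta>) + f x powr (\<alpha> - \<delta>)"
        by (rule powr_exp_ln_split) fact
      finally have "f x powr \<alpha> * \<bar>ln (f x)\<bar> \<le> (f x powr (\<alpha> + \<delta>) + f x powr (\<alpha> - \<delta>)) / \<delta>"
        using \<delta>(1) by (simp add: field_simps)
      then have "f x powr \<alpha> * \<bar>ln (f x)\<bar> * \<bar>ln (f x)\<bar> ^ k
          \<le> (f x powr (\<alpha> + \<delta>) + f x powr (\<alpha> - \<delta>)) / \<delta> * \<bar>ln (f x)\<bar> ^ k"
        by (intro mult_right_mono) auto
      also have "\<dots> = ?g x"
        by (simp add: abs_mult power_abs algebra_simps add_divide_distrib)
      also have "\<dots> \<le> norm (?g x)" unfolding real_norm_def by (rule abs_ge_self)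
      finally show ?thesis by (simp add: abs_mult power_abs mult_ac)
    qed
    then show "AE x in \<mu>. norm (f x powr \<alpha> * ln (f x) ^ Suc k) \<le> norm (?g x)" by simp
  qed measurable
qed

text \<open>
  Since \<open>f\<^sup>\<alpha>\<^sup>+\<^sup>t = f\<^sup>\<alpha> exp (t ln f)\<close>, the error of the first-order expansion in \<open>t\<close> is at most
  \<open>t\<^sup>2 f\<^sup>\<alpha> \<bar>ln f\<bar>\<^sup>k\<^sup>+\<^sup>2 exp (\<delta> \<bar>ln f\<bar>)\<close> for \<open>\<bar>t\<bar> < \<delta>\<close>. For \<open>\<delta> < \<alpha>\<close> this is \<open>t\<^sup>2\<close> times an
  integrable function independent of \<open>t\<close>, so the difference quotient is off by \<open>O(t)\<close>.
\<close>

lemma log_moment_has_derivative: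
  assumes "\<alpha> > 0"
  shows "(log_moment k has_real_derivative log_moment (Suc k) \<alpha>) (at \<alpha>)"
proof -
  define \<delta> where "\<delta> = \<alpha> / 2"
  have \<delta>: "\<delta> > 0" "\<alpha> + \<delta> > 0" "\<alpha> - \<delta> > 0" using assms by (auto simp: \<delta>_def)
  let ?b = "\<lambda>x. \<bar>f x powr (\<alpha> + \<delta>) * ln (f x) ^ (k + 2)\<bar> + \<bar>f x powr (\<alpha> - \<delta>) * ln (f x) ^ (k + 2)\<bar>"
  define C where "C = (LINT x|\<mu>. ?b x)"
  have int_b: "integrable \<mu> ?b"
    using \<delta> by (intro Bochner_Integration.integrable_add integrable_abs integrable_powr_ln_power)
  have bound: "\<bar>(log_moment k (\<alpha> + t) - log_moment k \<alpha>) / t - log_moment (Suc k) \<alpha>\<bar> \<le> C * \<bar>t\<bar>"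
    if t: "t \<noteq> 0" "\<bar>t\<bar> < \<delta>" for t
  proof -
    have pos: "\<alpha> + t > 0" using t \<delta> by linarith
    note int = integrable_powr_ln_power[OF pos, of k] integrable_powr_ln_power[OF assms, of k]
      integrable_powr_ln_power[OF assms, of "Suc k"]
    let ?r = "\<lambda>x. f x powr (\<alpha> + t) * ln (f x) ^ k - f x powr \<alpha> * ln (f x) ^ k
      - t * (f x powr \<alpha> * ln (f x) ^ Suc k)"
    have int_r: "integrable \<mu> ?r"
      by (intro Bochner_Integration.integrable_diff integrable_mult_right int)
    have r: "\<bar>?r x\<bar> \<le> t\<^sup>2 * ?b x" for x
    proof (cases "f x = 0")
      case False
      then have fx: "f x > 0" using nonneg_f[of x] by simp
      define l where "l = ln (f x)"
      have "?r x = f x powr \<alpha> * l ^ k * (exp (t * l) - 1 - t * l)"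
        using fx by (simp add: powr_def l_def exp_add algebra_simps)
      then have "\<bar>?r x\<bar> = f x powr \<alpha> * \<bar>l\<bar> ^ k * \<bar>exp (t * l) - 1 - t * l\<bar>"
        by (simp only: abs_mult power_abs) simp
      also have "\<dots> \<le> f x powr \<alpha> * \<bar>l\<bar> ^ k * ((t * l)\<^sup>2 * exp (\<bar>t * l\<bar>))"
        by (intro mult_left_mono exp_abs_remainder) auto
      also have "\<dots> \<le> f x powr \<alpha> * \<bar>l\<bar> ^ k * ((t * l)\<^sup>2 * exp (\<delta> * \<bar>l\<bar>))"
        using t(2) by (intro mult_left_mono) (auto simp: abs_mult intro!: mult_right_mono)
      also have "\<dots> = t\<^sup>2 * \<bar>l\<bar> ^ (k + 2) * (f x powr \<alpha> * exp (\<delta> * \<bar>l\<bar>))"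
        by (simp add: power_mult_distrib power_add power2_eq_square mult_ac)
      also have "\<dots> \<le> t\<^sup>2 * \<bar>l\<bar> ^ (k + 2) * (f x powr (\<alpha> + \<delta>) + f x powr (\<alpha> - \<delta>))"
        unfolding l_def using \<delta>(1) by (intro mult_left_mono powr_exp_ln_split) auto
      also have "\<dots> = t\<^sup>2 * ?b x"
        by (simp only: abs_mult power_abs l_def) (simp add: algebra_simps)
      finally show ?thesis .
    qed simp
    have "\<bar>log_moment k (\<alpha> + t) - log_moment k \<alpha> - t * log_moment (Suc k) \<alpha>\<bar> = \<bar>LINT x|\<mu>. ?r x\<bar>"
      unfolding log_moment_def using int by (simp del: power_Suc)
    also have "\<dots> \<le> (LINT x|\<mu>. \<bar>?r x\<bar>)" by (rule integral_abs_bound)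
    also have "\<dots> \<le> (LINT x|\<mu>. t\<^sup>2 * ?b x)"
      by (intro integral_mono r integrable_abs int_r integrable_mult_right int_b)
    also have "\<dots> = t\<^sup>2 * C" by (simp add: C_def)
    finally have "\<bar>log_moment k (\<alpha> + t) - log_moment k \<alpha> - t * log_moment (Suc k) \<alpha>\<bar> / \<bar>t\<bar> \<le> t\<^sup>2 * C / \<bar>t\<bar>"
      by (intro divide_right_mono) auto
    moreover have "(log_moment k (\<alpha> + t) - log_moment k \<alpha>) / t - log_moment (Suc k) \<alpha>
        = (log_moment k (\<alpha> + t) - log_moment k \<alpha> - t * log_moment (Suc k) \<alpha>) / t"
      using t(1) by (simp add: field_simps)
    moreover have "t\<^sup>2 * C / \<bar>t\<bar> = C * \<bar>t\<bar>"
      using t(1) by (cases "t > 0") (auto simp: field_simps power2_eq_square)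
    ultimately show ?thesis by (simp add: abs_divide)
  qed
  have "((\<lambda>t. (log_moment k (\<alpha> + t) - log_moment k \<alpha>) / t - log_moment (Suc k) \<alpha>) \<longlongrightarrow> 0) (at 0)"
  proof (rule tendsto_rabs_zero_cancel, rule tendsto_sandwich[of "\<lambda>_. 0" _ _ "\<lambda>t. C * \<bar>t\<bar>"])
    show "\<forall>\<^sub>F t in at 0. \<bar>(log_moment k (\<alpha> + t) - log_moment k \<alpha>) / t - log_moment (Suc k) \<alpha>\<bar> \<le> C * \<bar>t\<bar>"
      unfolding eventually_at using bound \<delta>(1) by (auto simp: dist_real_def)
    show "((\<lambda>t. C * \<bar>t\<bar>) \<longlongrightarrow> 0) (at 0)"
      by (auto intro!: tendsto_eq_intros)
  qed auto
  then show ?thesis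
    unfolding DERIV_def by (simp add: LIM_zero_iff)
qed

lemma log_moment_0_pos: "log_moment 0 \<alpha> > 0" if "\<alpha> > 0"
proof -
  have "log_moment 0 \<alpha> \<noteq> 0"
  proof
    assume "log_moment 0 \<alpha> = 0"
    then have "AE x in \<mu>. f x powr \<alpha> = 0"
      using integral_nonneg_eq_0_iff_AE[OF integrable_powr[OF that]] by (simp add: log_moment_def)
    then show False using not_null by simp
  qed
  moreover have "log_moment 0 \<alpha> \<ge> 0" unfolding log_moment_def by simp
  ultimately show ?thesis by simp
qed

text \<open>
  Mean and variance of \<open>ln f\<close> under the probability density \<open>f\<^sup>\<alpha> / \<integral> f\<^sup>\<alpha>\<close>.
\<close>

definition tilted_mean :: "real \<Rightarrow> real" where
  "tilted_mean \<alpha> = log_moment 1 \<alpha> / log_moment 0 \<alpha>"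

definition tilted_var :: "real \<Rightarrow> real" where
  "tilted_var \<alpha> = log_moment 2 \<alpha> / log_moment 0 \<alpha> - (tilted_mean \<alpha>)\<^sup>2"

lemma ln_log_moment_0_derivs:
  assumes "\<alpha> > 0"
  shows "((\<lambda>a. ln (log_moment 0 a)) has_real_derivative tilted_mean \<alpha>) (at \<alpha>)"
    and "(tilted_mean has_real_derivative tilted_var \<alpha>) (at \<alpha>)"
proof -
  note [derivative_intros] = log_moment_has_derivative[OF assms]
  note pos = log_moment_0_pos[OF assms]
  show "((\<lambda>a. ln (log_moment 0 a)) has_real_derivative tilted_mean \<alpha>) (at \<alpha>)"
    using pos by (auto intro!: derivative_eq_intros simp: tilted_mean_def)
  have "((\<lambda>a. log_moment 1 a / log_moment 0 a) has_real_derivative tilted_var \<alpha>) (at \<alpha>)"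
    using pos by (auto intro!: derivative_eq_intros
      simp: tilted_mean_def tilted_var_def field_simps power2_eq_square numeral_2_eq_2)
  then show "(tilted_mean has_real_derivative tilted_var \<alpha>) (at \<alpha>)"
    by (simp add: tilted_mean_def [abs_def])
qed

text \<open>
  The hypothesis says that \<open>K * (\<alpha> - 1 - ln \<alpha>) - ln (log_moment 0 \<alpha>)\<close> has a nonnegative second
  derivative. So it is convex and lies above its tangent at \<open>1\<close>, where the first term and its
  derivative vanish.
\<close>

lemma ln_log_moment_0_le:
  assumes bound: "\<And>a. a > 0 \<Longrightarrow> a\<^sup>2 * tilted_var a \<le> K" and \<alpha>: "\<alpha> > 0"
  shows "ln (log_moment 0 \<alpha>) \<le> ln (log_moment 0 1) + (\<alpha> - 1) * tilted_mean 1
    + K * (\<alpha> - 1 - ln \<alpha>)"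
proof -
  define \<phi> where "\<phi> a = K * (a - 1 - ln a) - ln (log_moment 0 a)" for a
  define \<phi>' where "\<phi>' a = K * (1 - 1 / a) - tilted_mean a" for a
  define \<phi>'' where "\<phi>'' a = K / a\<^sup>2 - tilted_var a" for a
  have d1: "(\<phi> has_real_derivative \<phi>' a) (at a)" if "a > 0" for a
  proof -
    have "((\<lambda>a. K * (a - 1 - ln a)) has_real_derivative K * (1 - 1 / a)) (at a)"
      using that by (auto intro!: derivative_eq_intros)
    from DERIV_diff[OF this ln_log_moment_0_derivs(1)[OF that]] show ?thesis
      unfolding \<phi>_def \<phi>'_def .
  qed
  have d2: "(\<phi>' has_real_derivative \<phi>'' a) (at a)" if "a > 0" for a
  proof -
    have "((\<lambda>a. K * (1 - 1 / a)) has_real_derivative K / a\<^sup>2) (at a)"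
      using that by (auto intro!: derivative_eq_intros simp: power2_eq_square)
    from DERIV_diff[OF this ln_log_moment_0_derivs(2)[OF that]] show ?thesis
      unfolding \<phi>'_def \<phi>''_def .
  qed
  have "\<phi>'' a \<ge> 0" if "a > 0" for a
    using bound[OF that] that by (simp add: \<phi>''_def field_simps)
  then have "convex_on {0<..} \<phi>"
    using d1 d2 by (intro f''_ge0_imp_convex[of _ _ \<phi>' \<phi>'']) auto
  then have "\<phi> \<alpha> - \<phi> 1 \<ge> \<phi>' 1 * (\<alpha> - 1)"
    using \<alpha> d1[of 1] by (intro convex_on_imp_above_tangent[of "{0<..}"])
      (auto simp: interior_open has_field_derivative_at_within)
  then show ?thesis by (simp add: \<phi>_def \<phi>'_def algebra_simps)
qed

text \<open>
  The factor \<open>\<alpha>\<close> inside the square is there because \<open>\<alpha> * (ln f - tilted_mean \<alpha>)\<close> is the centred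
  logarithm of the normalised power \<open>f\<^sup>\<alpha> / \<integral> f\<^sup>\<alpha>\<close>, whose additive constant \<open>- ln (\<integral> f\<^sup>\<alpha>)\<close> cancels.
\<close>

lemma nn_integral_centred:
  assumes "\<alpha> > 0"
  shows "(\<integral>\<^sup>+x. ennreal (f x powr \<alpha> / log_moment 0 \<alpha> * (\<alpha> * (ln (f x) - tilted_mean \<alpha>))\<^sup>2) \<partial>\<mu>)
    = ennreal (\<alpha>\<^sup>2 * tilted_var \<alpha>)"
proof -
  note int = integrable_powr_ln_power[OF assms]
  note pos = log_moment_0_pos[OF assms]
  let ?h = "\<lambda>x. \<alpha>\<^sup>2 / log_moment 0 \<alpha> * (f x powr \<alpha> * ln (f x) ^ 2
      - 2 * tilted_mean \<alpha> * (f x powr \<alpha> * ln (f x) ^ 1)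
      + (tilted_mean \<alpha>)\<^sup>2 * (f x powr \<alpha> * ln (f x) ^ 0))"
  have eq: "f x powr \<alpha> / log_moment 0 \<alpha> * (\<alpha> * (ln (f x) - tilted_mean \<alpha>))\<^sup>2 = ?h x" for x
    by (simp add: power2_eq_square algebra_simps)
  have "integrable \<mu> ?h"
    by (intro integrable_mult_right Bochner_Integration.integrable_add
        Bochner_Integration.integrable_diff int)
  moreover have "?h x \<ge> 0" for x
    unfolding eq[symmetric] using pos by simp
  ultimately have "(\<integral>\<^sup>+x. ennreal (?h x) \<partial>\<mu>) = ennreal (LINT x|\<mu>. ?h x)"
    by (intro nn_integral_eq_integral) auto
  also have "(LINT x|\<mu>. ?h x)
      = \<alpha>\<^sup>2 / log_moment 0 \<alpha> * (log_moment 2 \<alpha> - 2 * tilted_mean \<alpha> * log_moment 1 \<alpha> + (tilted_mean \<alpha>)\<^sup>2 * log_moment 0 \<alpha>)"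
    unfolding log_moment_def
    using int[of 0] int[of 1] int[of 2] by simp
  also have "\<dots> = \<alpha>\<^sup>2 * tilted_var \<alpha>"
    using pos by (simp add: tilted_mean_def tilted_var_def field_simps power2_eq_square)
  finally show ?thesis by (simp only: eq)
qed

end

section \<open>Varentropy of the normalised powers\<close>

text \<open>
  Off the zeros of \<open>f\<close>, the information content of the normalised power is
  \<open>- \<alpha> * ln f\<close> up to an additive constant, so its variance is \<open>\<alpha>\<^sup>2\<close> times that of \<open>ln f\<close>.
\<close>

lemma varentropy_power_density:
  fixes f :: "'b::euclidean_space \<Rightarrow> real"
  assumes "finite_powers lborel f" and \<alpha>: "\<alpha> > 0"
    and dist: "distributed N lborel Y (\<lambda>x. ennreal (power_density f \<alpha> x))"
  shows "varentropy N (power_density f \<alpha>) Y = ennreal (\<alpha>\<^sup>2 * finite_powers.tilted_var lborel f \<alpha>)"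
proof -
  interpret finite_powers lborel f by fact
  define Z where "Z = log_moment 0 \<alpha>"
  have Z: "Z > 0" unfolding Z_def by (rule log_moment_0_pos) fact
  let ?p = "power_density f \<alpha>"
  have p: "?p = (\<lambda>x. f x powr \<alpha> / Z)"
    by (simp add: fun_eq_iff power_density_def Z_def log_moment_def)
  have ln_p: "ln (?p x) = \<alpha> * ln (f x) - ln Z" if "f x \<noteq> 0" for x
    using that nonneg_f[of x] Z by (simp add: p ln_div)
  have [measurable]: "?p \<in> borel_measurable lborel" unfolding p by measurable
  have p_nonneg: "0 \<le> ?p x" for x using Z by (simp add: p)
  note int = integrable_powr_ln_power[OF \<alpha>]
  have "?p x * ln (?p x)
      = \<alpha> / Z * (f x powr \<alpha> * ln (f x) ^ 1) - ln Z / Z * (f x powr \<alpha> * ln (f x) ^ 0)" for x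
    by (cases "f x = 0") (simp_all add: ln_p, simp_all add: p algebra_simps)
  then have "(LINT x|lborel. ?p x * ln (?p x)) = (LINT x|lborel.
      \<alpha> / Z * (f x powr \<alpha> * ln (f x) ^ 1) - ln Z / Z * (f x powr \<alpha> * ln (f x) ^ 0))"
    by simp
  also have "\<dots> = \<alpha> / Z * log_moment 1 \<alpha> - ln Z / Z * log_moment 0 \<alpha>"
    unfolding log_moment_def using int[of 1] int[of 0] by simp
  also have "\<dots> = \<alpha> * tilted_mean \<alpha> - ln Z"
    using Z by (simp add: tilted_mean_def Z_def)
  finally have ent: "diff_entropy N ?p Y = ln Z - \<alpha> * tilted_mean \<alpha>"
    using diff_entropy_eq_integral[OF dist p_nonneg] by simp
  have "varentropy N ?p Y
      = (\<integral>\<^sup>+x. ennreal (?p x) * ennreal ((- ln (?p x) - diff_entropy N ?p Y)\<^sup>2) \<partial>lborel)"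
    unfolding varentropy_def info_content_def
    by (rule distributed_nn_integral[OF dist, symmetric]) measurable
  also have "\<dots> = (\<integral>\<^sup>+x. ennreal (f x powr \<alpha> / Z * (\<alpha> * (ln (f x) - tilted_mean \<alpha>))\<^sup>2) \<partial>lborel)"
  proof (intro nn_integral_cong)
    fix x
    have "?p x * (- ln (?p x) - diff_entropy N ?p Y)\<^sup>2
        = f x powr \<alpha> / Z * (\<alpha> * (ln (f x) - tilted_mean \<alpha>))\<^sup>2"
    proof (cases "f x = 0")
      case False
      have "- ln (?p x) - diff_entropy N ?p Y = - (\<alpha> * (ln (f x) - tilted_mean \<alpha>))"
        using False by (simp add: ln_p ent algebra_simps)
      then show ?thesis by (simp only: power2_minus) (simp add: p)
    qed (simp add: p)
    then show "ennreal (?p x) * ennreal ((- ln (?p x) - diff_entropy N ?p Y)\<^sup>2)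
        = ennreal (f x powr \<alpha> / Z * (\<alpha> * (ln (f x) - tilted_mean \<alpha>))\<^sup>2)"
      by (simp add: p_nonneg flip: ennreal_mult)
  qed
  also have "\<dots> = ennreal (\<alpha>\<^sup>2 * tilted_var \<alpha>)"
    unfolding Z_def by (rule nn_integral_centred) fact
  finally show ?thesis .
qed

section \<open>The exponential moment bound\<close>

lemma
  fixes f :: "'b::euclidean_space \<Rightarrow> real"
  assumes M: "prob_space M" and nonneg: "\<And>x. 0 \<le> f x"
    and dist: "distributed M lborel X (\<lambda>x. ennreal (f x))"
    and int: "\<And>\<alpha>. \<alpha> > 0 \<Longrightarrow> integrable lborel (\<lambda>x. f x powr \<alpha>)"
  shows finite_powers_density: "finite_powers lborel f"
    and log_moment_density: "finite_powers.log_moment lborel f 0 1 = 1"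
    and diff_entropy_eq_tilted_mean: "diff_entropy M f X = - finite_powers.tilted_mean lborel f 1"
proof -
  interpret prob_space M by fact
  have [measurable]: "f \<in> borel_measurable lborel"
    using distributed_real_measurable[OF _ dist] nonneg by simp
  have "(\<integral>\<^sup>+x. ennreal (f x) * 1 \<partial>lborel) = (\<integral>\<^sup>+\<omega>. 1 \<partial>M)"
    by (rule distributed_nn_integral[OF dist]) simp
  then have total: "(\<integral>\<^sup>+x. ennreal (f x) \<partial>lborel) = 1"
    by (simp add: emeasure_space_1)
  show fp: "finite_powers lborel f"
  proof
    show "\<not> (AE x in lborel. f x = 0)"
    proof
      assume "AE x in lborel. f x = 0"
      then have "(\<integral>\<^sup>+x. ennreal (f x) \<partial>lborel) = (\<integral>\<^sup>+x. 0 \<partial>(lborel::'b measure))"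
        by (intro nn_integral_cong_AE) auto
      with total show False by simp
    qed
  qed (use nonneg int in auto)
  interpret finite_powers lborel f by (fact fp)
  have "(LINT x|lborel. f x) = 1"
    using total nonneg by (subst integral_eq_nn_integral) auto
  then show 1: "log_moment 0 1 = 1"
    by (simp add: log_moment_def nonneg)
  show "diff_entropy M f X = - tilted_mean 1"
    using diff_entropy_eq_integral[OF dist nonneg] nonneg
    by (simp add: tilted_mean_def 1) (simp add: log_moment_def)
qed

theorem theorem3p1:
  fixes M :: "'a measure" and X :: "'a \<Rightarrow> real ^ 'n"
    and f :: "real ^ 'n \<Rightarrow> real"
    and N :: "real \<Rightarrow> 'b measure" and X\<alpha> :: "real \<Rightarrow> 'b \<Rightarrow> real ^ 'n"
    and K :: ennreal and \<beta> :: real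
  assumes "prob_space M"
    and "\<And>x. 0 \<le> f x"
    and "distributed M lborel X (\<lambda>x. ennreal (f x))"
    and "\<And>\<alpha>. \<alpha> > 0 \<Longrightarrow> integrable lborel (\<lambda>x. f x powr \<alpha>)"
    and "\<And>\<alpha>. \<alpha> > 0 \<Longrightarrow> prob_space (N \<alpha>)"
    and "\<And>\<alpha>. \<alpha> > 0 \<Longrightarrow>
           distributed (N \<alpha>) lborel (X\<alpha> \<alpha>) (\<lambda>x. ennreal (power_density f \<alpha> x))"
    and "K = (SUP \<alpha>\<in>{0<..}. varentropy (N \<alpha>) (power_density f \<alpha>) (X\<alpha> \<alpha>))"
  shows "(\<integral>\<^sup>+\<omega>. ennreal (exp (\<beta> * (info_content f X \<omega> - diff_entropy M f X))) \<partial>M)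
           \<le> exp_ext (enn2ereal K * rate_fun (-\<beta>))"
proof -
  interpret prob_space M by fact
  note density = assms(1-4)
  interpret finite_powers lborel f by (rule finite_powers_density[OF density])
  define m where "m = tilted_mean 1"
  have h: "diff_entropy M f X = - m"
    unfolding m_def by (rule diff_entropy_eq_tilted_mean[OF density])
  have mass: "log_moment 0 1 = 1" by (rule log_moment_density[OF density])
  have var_le: "ennreal (\<alpha>\<^sup>2 * tilted_var \<alpha>) \<le> K" if "\<alpha> > 0" for \<alpha>
    unfolding assms(7)
    using varentropy_power_density[OF finite_powers_axioms that assms(6)[OF that]] that
    by (intro SUP_upper2[of \<alpha>]) auto
  have exp_ext_0: "exp_ext 0 = 1"
    using exp_ext_simps(1)[of 0] by (simp flip: zero_ereal_def)
  let ?L = "\<integral>\<^sup>+\<omega>. ennreal (exp (\<beta> * (info_content f X \<omega> - diff_entropy M f X))) \<partial>M"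
  have "?L = (\<integral>\<^sup>+x. ennreal (f x) * ennreal (exp (\<beta> * (m - ln (f x)))) \<partial>lborel)"
    unfolding h info_content_def
    by (subst distributed_nn_integral[OF assms(3)]) (auto simp: algebra_simps)
  then have L: "?L = (\<integral>\<^sup>+x. ennreal (f x * exp (\<beta> * (m - ln (f x)))) \<partial>lborel)"
    by (simp add: ennreal_mult nonneg_f)
  show ?thesis
  proof (cases "\<beta> < 1")
    case True
    then have pos: "1 - \<beta> > 0" by simp
    have "f x * exp (\<beta> * (m - ln (f x))) = exp (\<beta> * m) * f x powr (1 - \<beta>)" for x
    proof (cases "f x = 0")
      case False
      then have fx: "f x > 0" using nonneg_f[of x] by simp
      have "f x * exp (\<beta> * (m - ln (f x))) = exp (ln (f x)) * exp (\<beta> * (m - ln (f x)))"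
        using fx by simp
      also have "\<dots> = exp (\<beta> * m + (1 - \<beta>) * ln (f x))"
        by (simp add: mult_exp_exp algebra_simps)
      also have "\<dots> = exp (\<beta> * m) * f x powr (1 - \<beta>)"
        using fx by (simp add: powr_def exp_add)
      finally show ?thesis .
    qed simp
    then have "?L = (\<integral>\<^sup>+x. ennreal (exp (\<beta> * m) * f x powr (1 - \<beta>)) \<partial>lborel)"
      unfolding L by simp
    also have "\<dots> = ennreal (LINT x|lborel. exp (\<beta> * m) * f x powr (1 - \<beta>))"
      using integrable_powr[OF pos] by (intro nn_integral_eq_integral) auto
    also have "(LINT x|lborel. exp (\<beta> * m) * f x powr (1 - \<beta>))
        = exp (\<beta> * m + ln (log_moment 0 (1 - \<beta>)))"
      using log_moment_0_pos[OF pos] by (simp add: exp_add) (simp add: log_moment_def)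
    finally have L': "?L = ennreal (exp (\<beta> * m + ln (log_moment 0 (1 - \<beta>))))" .
    have rate: "rate_fun (- \<beta>) = ereal (- \<beta> - ln (1 - \<beta>))"
      using True by (simp add: rate_fun_def)
    show ?thesis
    \<comment> \<open>For infinite \<open>K\<close> the bound is infinite because the rate is positive, except at
      \<open>\<beta> = 0\<close>, where it is \<open>exp 0\<close> by \<open>\<infinity> * 0 = 0\<close>.\<close>
    proof (cases K)
      case (real k)
      have "a\<^sup>2 * tilted_var a \<le> k" if "a > 0" for a
        using var_le[OF that] real by (simp add: ennreal_le_iff)
      then have "ln (log_moment 0 (1 - \<beta>)) \<le> - \<beta> * m + k * (- \<beta> - ln (1 - \<beta>))"
        using ln_log_moment_0_le[of k, OF _ pos] by (simp add: mass m_def)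
      then show ?thesis
        unfolding L' rate using real by (simp add: enn2ereal_ennreal)
    next
      case top
      show ?thesis
      proof (cases "\<beta> = 0")
        case False
        have "ln (1 - \<beta>) < - \<beta>"
          using ln_le_minus_one[OF pos] ln_eq_minus_one[OF pos] False by force
        then show ?thesis by (simp add: top rate)
      next
        case True
        then show ?thesis
          by (simp add: rate_fun_def emeasure_space_1 exp_ext_0 flip: zero_ereal_def)
      qed
    qed
  next
    case False
    then have rate: "rate_fun (- \<beta>) = \<infinity>" by (simp add: rate_fun_def)
    \<comment> \<open>For \<open>K = 0\<close> the right-hand side is \<open>exp (0 * \<infinity>) = 1\<close>; as the varentropy
      vanishes at \<open>\<alpha> = 1\<close>, \<open>ln f = m\<close> almost everywhere on the support of \<open>f\<close>, so the
      integrand is \<open>f\<close> itself.\<close>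
    show ?thesis
    proof (cases "K = 0")
      case True
      then have "ennreal (1\<^sup>2 * tilted_var 1) = 0"
        using var_le[of 1] by simp
      then have "(\<integral>\<^sup>+x. ennreal (f x * (ln (f x) - m)\<^sup>2) \<partial>lborel) = 0"
        using nn_integral_centred[of 1] by (simp add: mass m_def nonneg_f)
      then have "AE x in lborel. ennreal (f x * (ln (f x) - m)\<^sup>2) = 0"
        by (subst (asm) nn_integral_0_iff_AE) auto
      then have "AE x in lborel. f x = 0 \<or> ln (f x) = m"
      proof eventually_elim
        case (elim x)
        moreover have "0 \<le> f x * (ln (f x) - m)\<^sup>2" using nonneg_f by simp
        ultimately have "f x * (ln (f x) - m)\<^sup>2 = 0"
          by (simp only: ennreal_eq_0_iff)
        then show ?case by simp
      qed
      then have "?L = (\<integral>\<^sup>+x. ennreal (f x powr 1) \<partial>lborel)"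
        unfolding L by (intro nn_integral_cong_AE) (auto simp: nonneg_f)
      also have "\<dots> = ennreal (log_moment 0 1)"
        using integrable_powr[of 1] by (subst nn_integral_eq_integral) (auto simp: log_moment_def)
      finally show ?thesis
        using True by (simp add: mass rate zero_ennreal.rep_eq exp_ext_0)
    next
      case False
      then have "enn2ereal K > 0"
        using less_ennreal.rep_eq[of 0 K] by (simp add: zero_ennreal.rep_eq zero_less_iff_neq_zero)
      then have "enn2ereal K * \<infinity> = \<infinity>" by simp
      then show ?thesis by (simp only: rate exp_ext_simps) simp
    qed
  qed
qed

end
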